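(* Let $n\ge 0$ be an integer and let $H_n(z)=(z+1)(z+2)\cdots(z+n+1)$. Define, for complex $s$, \[\eta_n(s)=\sum_{k=0}^{n}(-1)^{k}\binom{n}{k}(k+1)^{-s},\] and, for $0<\operatorname{Re} s<n+1$, \[L_n(s)=\int_0^{+\infty}\frac{x^{s-1}}{H_n(x)}\,dx .\] Then: (i) $\eta_n$ is an entire function and $\eta_n(-m)=0$ for every integer $m$ with $0\le m\le n-1$; (ii) for $0<\operatorname{Re} s<n+1$, \[L_n(s)=\frac{\pi}{\sin(s\pi)}\,\eta_n(1-s)\,\frac{1}{n!};\] (iii) by this formula $L_n$ extends meromorphically to the whole $s$-plane, with possible poles only at the integers, and with no poles at the points $s=m$, $0\le m\le n-1$. In particular, for $n=0$ this gives $\int_0^{+\infty}\frac{x^{s-1}}{x+1}\,dx=\frac{\pi}{\sin(s\pi)}$ for $0<\operatorname{Re}s<1$.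
   Context: $s$ denotes a complex variable $s=\sigma+it$; an inequality such as $0<s<n+1$ in the paper means $0<\operatorname{Re}s<n+1$. The power $x^{s-1}$ for $x>0$ is $e^{(s-1)\log x}$ with real logarithm, and $(k+1)^{-s}=e^{-s\log(k+1)}$. The function $\eta_n$ is the $n$-th term of Hasse's expansion $\eta(s)=\sum_{n\ge0}2^{-n-1}\eta_n(s)$ of the alternating zeta function.
   Formalization: In (iii) the claim of no pole at s=m, 0≤m≤n−1, fails at s=0 for n≥1 (η_n(1)=1/(n+1)≠0 gives a simple pole); it is proved for s=1,…,n instead. In (ii), at integers s, where the right side is 0/0, the formula is read as a limit. *)

theory Defs
  imports "HOL-Complex_Analysis.Complex_Analysis"
begin

definition H :: "nat \<Rightarrow> complex \<Rightarrow> complex" where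
  "H n z = (\<Prod>j=1..n+1. z + of_nat j)"

text \<open>For a positive real base, complex \<^const>\<open>powr\<close> uses the principal logarithm, which is then
  the real logarithm.\<close>

definition eta :: "nat \<Rightarrow> complex \<Rightarrow> complex" where
  "eta n s = (\<Sum>k=0..n. (- 1) ^ k * of_nat (n choose k) * of_nat (k + 1) powr (- s))"

definition L_integrand :: "nat \<Rightarrow> complex \<Rightarrow> real \<Rightarrow> complex" where
  "L_integrand n s x = of_real x powr (s - 1) / H n (of_real x)"

text \<open>Only meaningful for \<open>0 < Re s < n + 1\<close>, where the integral converges absolutely. The Bochner
  integral of a non-integrable function is \<open>0\<close>, so integrability has to be asserted separately.\<close>

definition L :: "nat \<Rightarrow> complex \<Rightarrow> complex" where
  "L n s = (LBINT x:{0<..}. L_integrand n s x)"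

text \<open>At integers \<open>s\<close> the denominator vanishes and this expression takes the junk value \<open>0\<close>; the
  intended value at the removable singularities is the limit.\<close>

definition L_formula :: "nat \<Rightarrow> complex \<Rightarrow> complex" where
  "L_formula n s = of_real pi / sin (s * of_real pi) * eta n (1 - s) * (1 / fact n)"

end

(* Substituting x = c t / (1 - t) in the Beta integral evaluates the integral of x^(s-1) / (x + c) over
   the positive reals for 0 < s < 1, and the partial fraction expansion of 1 / H_n then gives the formula
   for real s in (0, 1). The Mellin transform L_n is holomorphic on the strip 0 < Re s < n + 1, so by the
   identity theorem sin(pi s) L_n(s) = pi eta_n(1 - s) / n! holds on the whole strip. The zeros of eta_n
   at 0, -1, ..., 1 - n come from this identity at the integers 1, ..., n, where the sine vanishes and
   L_n is finite. *)

theory Submission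
  imports Defs
begin

section \<open>Partial fractions of the reciprocal of a rising factorial\<close>

text \<open>By Pascal's rule the sum for \<open>Suc n\<close> at \<open>z\<close> is the sum for
  \<open>n\<close> at \<open>z\<close> minus the sum for \<open>n\<close> at \<open>z + 1\<close>,
  so the induction must leave \<open>z\<close> arbitrary. The two resulting products share the
  factors from \<open>z + 1\<close> to \<open>z + n\<close>, and their reciprocals differ by
  \<open>n + 1\<close> over the product of all \<open>n + 2\<close> factors.\<close>

lemma sum_binomial_partial_fraction:
  fixes z :: "'a::field_char_0"
  assumes "\<And>k. k \<le> n \<Longrightarrow> z + of_nat k \<noteq> 0"
  shows "(\<Sum>k\<le>n. (- 1) ^ k * of_nat (n choose k) / (z + of_nat k)) = fact n / pochhammer z (Suc n)"
  using assms
proof (induction n arbitrary: z)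
  case 0
  then show ?case by simp
next
  case (Suc n)
  let ?g = "\<lambda>m k. (- 1) ^ k * of_nat (m choose k) / (z + of_nat k)"
  have nz: "z \<noteq> 0" "z + 1 + of_nat n \<noteq> 0"
    using Suc.prems[of 0] Suc.prems[of "Suc n"] by (simp_all add: add_ac)
  have nz': "z + of_nat k \<noteq> 0" if "k \<le> n" for k using Suc.prems[of k] that by simp
  have nz'': "z + 1 + of_nat k \<noteq> 0" if "k \<le> n" for k 
    using Suc.prems[of "Suc k"] that by (simp add: add_ac)
  have p: "pochhammer (z + 1) n \<noteq> 0"
    by (metis pochhammer_eq_0_iff less_imp_le nz'' add.left_inverse)
  have "(\<Sum>k\<le>Suc n. ?g (Suc n) k) = ?g (Suc n) 0 + (\<Sum>k\<le>n. ?g (Suc n) (Suc k))"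
    by (rule sum.atMost_Suc_shift)
  also have "(\<Sum>k\<le>n. ?g (Suc n) (Suc k)) = (\<Sum>k\<le>n. ?g n (Suc k)) -
      (\<Sum>k\<le>n. (- 1) ^ k * of_nat (n choose k) / (z + 1 + of_nat k))"
    by (simp add: sum_subtractf [symmetric] algebra_simps minus_diff_commute add_divide_distrib diff_divide_distrib)
  also have "?g (Suc n) 0 + ((\<Sum>k\<le>n. ?g n (Suc k)) -
      (\<Sum>k\<le>n. (- 1) ^ k * of_nat (n choose k) / (z + 1 + of_nat k))) =
      (\<Sum>k\<le>Suc n. ?g n k) - (\<Sum>k\<le>n. (- 1) ^ k * of_nat (n choose k) / (z + 1 + of_nat k))"
    by (simp del: sum.atMost_Suc add: sum.atMost_Suc_shift)
  \<comment> \<open>The term \<open>k = Suc n\<close> of the first sum carries the coefficient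
    \<open>n choose Suc n = 0\<close>, so both sums are instances of the induction
    hypothesis.\<close>
  also have "\<dots> = fact n / pochhammer z (Suc n) - fact n / pochhammer (z + 1) (Suc n)"
    using Suc.IH[of z] Suc.IH[of "z + 1"] nz' nz'' by simp
  also have "\<dots> = fact (Suc n) / pochhammer z (Suc (Suc n))"
    using nz p
    by (simp add: pochhammer_rec[of z] pochhammer_Suc[of "z + 1"] divide_simps) (simp add: algebra_simps)
  finally show ?case .
qed

section \<open>The Beta integral over the positive half-line\<close>

text \<open>The substitution \<open>x = c * t / (1 - t)\<close> maps the unit interval bijectively
  onto the half-line and turns the integrand into the Euler Beta integrand. Two instances matter
  later: \<open>b = 1 - a\<close> gives the kernel \<open>1 / (x + c)\<close> of a single partial
  fraction, and \<open>c = 1\<close> with \<open>a + b = n + 1\<close> gives a majorant for the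
  integrand of \<open>L n\<close>.\<close>

lemma
  fixes a b c :: real
  assumes a: "a > 0" and b: "b > 0" and c: "c > 0"
  shows set_integrable_Beta_prime:
      "set_integrable lborel {0<..} (\<lambda>x. x powr (a - 1) / (x + c) powr (a + b))" (is ?P)
    and set_integral_Beta_prime:
      "(LBINT x:{0<..}. x powr (a - 1) / (x + c) powr (a + b)) = Beta a b / c powr b" (is ?Q)
proof -
  define f where "f = (\<lambda>x::real. x powr (a - 1) / (x + c) powr (a + b))"
  define g where "g = (\<lambda>t::real. c * t / (1 - t))"
  define g' where "g' = (\<lambda>t::real. c / (1 - t)\<^sup>2)"
  have "f absolutely_integrable_on g ` {0<..<1} \<and> integral (g ` {0<..<1}) f = Beta a b / c powr b"
  proof (rule iffD1[OF has_absolute_integral_change_of_variables_1'[where g' = g']])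
    show "{0<..<1::real} \<in> sets lebesgue" by simp
    show "(g has_field_derivative g' t) (at t within {0<..<1})" if "t \<in> {0<..<1}" for t
      using that unfolding g_def g'_def
      by (auto intro!: derivative_eq_intros simp: power2_eq_square field_simps)
    show "inj_on g {0<..<1}"
      using c by (auto simp: g_def inj_on_def divide_simps) (simp add: algebra_simps)
    \<comment> \<open>All factors are positive, and \<open>g t + c = c / (1 - t)\<close>. Writing
      each one as an exponential of logarithms reduces the claim to a linear identity between
      exponents.\<close>
    have eq: "\<bar>g' t\<bar> * f (g t) = (t powr (a - 1) * (1 - t) powr (b - 1)) * (1 / c powr b)"
      if t: "t \<in> {0<..<1}" for t
    proof -
      have g't: "\<bar>g' t\<bar> = exp (ln c - 2 * ln (1 - t))"
        using t c by (simp add: g'_def exp_diff exp_double)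
      have gt: "g t = exp (ln c + ln t - ln (1 - t))"
        using t c by (simp add: g_def exp_diff exp_add)
      have gtc: "g t + c = exp (ln c - ln (1 - t))"
        using t c by (simp add: g_def exp_diff field_simps)
      have "\<bar>g' t\<bar> * f (g t) =
          exp (ln c - 2 * ln (1 - t) + (a - 1) * (ln c + ln t - ln (1 - t)) - (a + b) * (ln c - ln (1 - t)))"
        unfolding f_def gtc g't unfolding gt by (simp add: powr_def exp_diff[of _ "(a + b) * _"] exp_add[of _ "(a - 1) * _"])
      also have "\<dots> = exp ((a - 1) * ln t + (b - 1) * ln (1 - t) - b * ln c)"
        by (simp add: algebra_simps)
      also have "\<dots> = (t powr (a - 1) * (1 - t) powr (b - 1)) * (1 / c powr b)"
        using t c by (simp add: powr_def exp_add exp_diff)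
      finally show ?thesis .
    qed
    have hi: "((\<lambda>t. \<bar>g' t\<bar> * f (g t)) has_integral (Beta a b * (1 / c powr b))) {0<..<1}"
      using has_integral_mult_left[OF has_integral_Beta_real[OF a b], of "1 / c powr b"]
      by (subst has_integral_cong[OF eq]) (simp_all add: has_integral_Icc_iff_Ioo)
    \<comment> \<open>The integrand is nonnegative, so gauge integrability already gives absolute
      integrability.\<close>
    moreover have "(\<lambda>t. \<bar>g' t\<bar> * f (g t)) absolutely_integrable_on {0<..<1}"
      using hi by (intro nonnegative_absolutely_integrable_1) (auto simp: f_def)
    ultimately show "(\<lambda>t. \<bar>g' t\<bar> * f (g t)) absolutely_integrable_on {0<..<1} \<and>
        integral {0<..<1} (\<lambda>t. \<bar>g' t\<bar> * f (g t)) = Beta a b / c powr b"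
      by (auto simp: integral_unique)
  qed
  also have "g ` {0<..<1} = {0<..}"
  proof (intro equalityI subsetI)
    fix x :: real assume "x \<in> {0<..}"
    then have "x / (x + c) \<in> {0<..<1}" "g (x / (x + c)) = x"
      using c by (auto simp: g_def divide_simps)
    then show "x \<in> g ` {0<..<1}" by (metis image_eqI)
  qed (use c in \<open>auto simp: g_def\<close>)
  finally have *: "f absolutely_integrable_on {0<..}" "integral {0<..} f = Beta a b / c powr b"
    by auto
  \<comment> \<open>The change of variables lives on the completed Lebesgue measure; Borel
    measurability of the integrand brings the result back to \<open>lborel\<close>.\<close>
  show P: ?P
    using *(1) unfolding f_def set_integrable_def
    by (subst (asm) integrable_completion) measurable
  show ?Q
    using set_borel_integral_eq_integral(2)[OF P] *(2) by (simp add: f_def)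
qed

section \<open>Holomorphy of Mellin transforms on a strip\<close>

text \<open>The modulus of \<open>x powr (s - 1)\<close> depends only on \<open>Re s\<close>, so
  integrability for real exponents covers the strip. For holomorphy, the integral is a locally
  uniform limit of integrals over compact intervals, which are holomorphic by differentiation under
  the integral sign.\<close>

lemma
  fixes F :: "real \<Rightarrow> complex"
  assumes F: "continuous_on {0<..} F"
    and int: "\<And>\<sigma>. a < \<sigma> \<Longrightarrow> \<sigma> < b \<Longrightarrow> set_integrable lborel {0<..} (\<lambda>x. x powr (\<sigma> - 1) *\<^sub>R F x)"
  shows set_integrable_Mellin:
      "a < Re s \<Longrightarrow> Re s < b \<Longrightarrow> set_integrable lborel {0<..} (\<lambda>x. of_real x powr (s - 1) * F x)"
    and holomorphic_on_Mellin:
      "(\<lambda>s. LBINT x:{0<..}. of_real x powr (s - 1) * F x) holomorphic_on {s. a < Re s \<and> Re s < b}"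
proof -
  let ?f = "\<lambda>s x. complex_of_real x powr (s - 1) * F x"
  \<comment> \<open>Compact intervals that exhaust the half-line while avoiding the possible
    singularity at 0; the shift by 1 keeps the left end defined for \<open>k = 0\<close>.\<close>
  define I where "I = (\<lambda>k. {1 / (real k + 1)..real k + 1})"
  have I_subset: "I k \<subseteq> {0<..}" for k
    unfolding I_def by (auto intro: less_le_trans[rotated])
  have cont: "continuous_on {0<..} (?f s)" for s
    using F by (intro continuous_intros) (auto simp: complex_nonpos_Reals_iff)
  have integrable: "set_integrable lborel {0<..} (?f s)" if "a < Re s" "Re s < b" for s
  proof (rule set_integrable_bound[OF int[OF that]])
    show "set_borel_measurable lborel {0<..} (?f s)"
      unfolding set_borel_measurable_def
      using borel_measurable_continuous_on_indicator[OF _ cont] by simp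
  qed (auto simp: norm_mult norm_powr_real_powr)
  show "a < Re s \<Longrightarrow> Re s < b \<Longrightarrow> set_integrable lborel {0<..} (?f s)"
    by (rule integrable)
  show "(\<lambda>s. LBINT x:{0<..}. ?f s x) holomorphic_on {s. a < Re s \<and> Re s < b}" (is "_ holomorphic_on ?S")
  proof (rule holomorphic_uniform_sequence)
    have S: "?S = {s. Re s > a} \<inter> {s. Re s < b}" by auto
    show "open ?S" unfolding S by (intro open_Int open_halfspace_Re_gt open_halfspace_Re_lt)
    have convex: "convex ?S" unfolding S
      by (intro convex_Int convex_halfspace_Re_gt convex_halfspace_Re_lt)
    show "(\<lambda>s. LBINT x:I k. ?f s x) holomorphic_on ?S" for k
    proof -
      have "(\<lambda>s. integral (cbox (1 / (real k + 1)) (real k + 1)) (?f s)) holomorphic_on ?S"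
      proof (rule leibniz_rule_holomorphic[OF _ _ _ convex])
        show "((\<lambda>s. ?f s x) has_field_derivative Ln (of_real x) * of_real x powr (s - 1) * F x) (at s within ?S)"
          if "x \<in> cbox (1 / (real k + 1)) (real k + 1)" for s x
        proof -
          have "x > 0" using that I_subset[of k] by (auto simp: I_def)
          then have "((\<lambda>s. of_real x powr s) has_field_derivative Ln (of_real x) * of_real x powr (s - 1)) (at (s - 1))"
            by (intro has_field_derivative_powr_right) simp
          from DERIV_chain2[where g = "\<lambda>s. s - 1", OF this, of 1 ?S]
          have "((\<lambda>s. of_real x powr (s - 1)) has_field_derivative Ln (of_real x) * of_real x powr (s - 1)) (at s within ?S)"
            by (simp add: DERIV_diff[OF DERIV_ident DERIV_const, simplified])
          then show ?thesis by (rule DERIV_cmult_right)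
        qed
        show "?f s integrable_on cbox (1 / (real k + 1)) (real k + 1)" for s
          using I_subset[of k] 
          by (intro integrable_continuous continuous_on_subset[OF cont]) (auto simp: I_def)
        show "continuous_on (?S \<times> cbox (1 / (real k + 1)) (real k + 1))
            (\<lambda>(s, x). Ln (of_real x) * of_real x powr (s - 1) * F x)"
          using I_subset[of k] unfolding case_prod_unfold
          by (intro continuous_intros continuous_on_compose2[OF F])
             (force simp: complex_nonpos_Reals_iff I_def)+
      qed
      moreover have "integral (cbox (1 / (real k + 1)) (real k + 1)) (?f s) = (LBINT x:I k. ?f s x)"
        if "s \<in> ?S" for s
        unfolding I_def cbox_interval[symmetric]
        by (subst set_borel_integral_eq_integral(2)) 
           (use that I_subset[of k] in \<open>auto intro!: set_integrable_subset[OF integrable[of s]] simp: I_def\<close>)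
      ultimately show ?thesis
        by (rule holomorphic_transform)
    qed
    show "\<exists>d>0. cball s d \<subseteq> ?S \<and> uniform_limit (cball s d) (\<lambda>k s. LBINT x:I k. ?f s x)
        (\<lambda>s. LBINT x:{0<..}. ?f s x) sequentially" if s: "s \<in> ?S" for s
    proof -
      obtain d where d: "d > 0" "cball s d \<subseteq> ?S"
        using \<open>open ?S\<close> s open_contains_cball by blast
      have "s - of_real d \<in> cball s d" "s + of_real d \<in> cball s d"
        using d(1) by (auto simp: dist_norm)
      with d(2) have "s - of_real d \<in> ?S" "s + of_real d \<in> ?S" by blast+
      then have ab: "a < Re s - d" "Re s - d < b" "a < Re s + d" "Re s + d < b" by auto
      \<comment> \<open>A majorant for all \<open>z\<close> in the disc at once: the power with the
        smallest real exponent dominates for \<open>x \<le> 1\<close>, the one with the largest for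
        \<open>x > 1\<close>. Both exponents stay inside the strip, so \<open>w\<close> is
        integrable.\<close>
      define w where "w = (\<lambda>x. norm (x powr (Re s - d - 1) *\<^sub>R F x) + norm (x powr (Re s + d - 1) *\<^sub>R F x))"
      have w: "set_integrable lborel {0<..} w"
        unfolding w_def using ab by (intro set_integral_add set_integrable_norm int)
      have bound: "norm (?f z x) \<le> w x" if "z \<in> cball s d" "x > 0" for z x
      proof -
        have "\<bar>Re (s - z)\<bar> \<le> d"
          using that abs_Re_le_cmod[of "s - z"] by (simp add: dist_norm)
        then have Re: "Re s - d - 1 \<le> Re z - 1" "Re z - 1 \<le> Re s + d - 1" by auto
        have "x powr (Re z - 1) \<le> x powr (Re s - d - 1) + x powr (Re s + d - 1)"
        proof (cases "x \<le> 1")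
          case True
          with Re that have "x powr (Re z - 1) \<le> x powr (Re s - d - 1)" by (intro powr_mono') auto
          then show ?thesis by (simp add: add_increasing2)
        next
          case False
          with Re have "x powr (Re z - 1) \<le> x powr (Re s + d - 1)" by (intro powr_mono) auto
          then show ?thesis by (simp add: add_increasing)
        qed
        then have "x powr (Re z - 1) * norm (F x) \<le> (x powr (Re s - d - 1) + x powr (Re s + d - 1)) * norm (F x)"
          by (rule mult_right_mono) simp
        with that show ?thesis 
          by (simp add: w_def norm_mult norm_powr_real_powr algebra_simps)
      qed
      \<comment> \<open>Dominated convergence with majorant \<open>w\<close>: a fixed
        \<open>x > 0\<close> lies in \<open>I k\<close> as soon as \<open>k\<close> exceeds both
        \<open>x\<close> and \<open>1 / x\<close>, so the indicators of the complements tend to 0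
        pointwise.\<close>
      have tail: "(\<lambda>k. LBINT x:{0<..} - I k. w x) \<longlonglongrightarrow> 0"
      proof -
        have "(\<lambda>k. LBINT x. indicator ({0<..} - I k) x *\<^sub>R w x) \<longlonglongrightarrow> (LBINT x::real. 0)"
        proof (rule integral_dominated_convergence)
          show wi: "integrable lborel (\<lambda>x. indicator {0<..} x *\<^sub>R w x)"
            using w by (simp add: set_integrable_def)
          show "(\<lambda>x. indicator ({0<..} - I k) x *\<^sub>R w x) \<in> borel_measurable lborel" for k
            using set_integrable_subset[OF w, of "{0<..} - I k"] 
            by (intro borel_measurable_integrable) (auto simp: I_def set_integrable_def)
          show "AE x in lborel. (\<lambda>k. indicator ({0<..} - I k) x *\<^sub>R w x) \<longlonglongrightarrow> 0"
          proof (rule AE_I2)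
            fix x :: real
            have "eventually (\<lambda>k. x > 0 \<longrightarrow> x \<in> I k) sequentially"
            proof (cases "x > 0")
              case True
              have "eventually (\<lambda>k. k \<ge> nat \<lceil>max x (1 / x)\<rceil>) sequentially"
                by (rule eventually_ge_at_top)
              then show ?thesis
              proof eventually_elim
                case (elim k)
                then have "max x (1 / x) \<le> real k" by linarith
                with True show ?case by (auto simp: I_def field_simps add_increasing)
              qed
            qed auto
            then have "eventually (\<lambda>k. indicator ({0<..} - I k) x *\<^sub>R w x = 0) sequentially"
              by eventually_elim (auto simp: indicator_def)
            then show "(\<lambda>k. indicator ({0<..} - I k) x *\<^sub>R w x) \<longlonglongrightarrow> 0"
              by (rule tendsto_eventually)
          qed
          show "AE x in lborel. norm (indicator ({0<..} - I k) x *\<^sub>R w x) \<le> indicator {0<..} x *\<^sub>R w x" for k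
            by (auto simp: indicator_def w_def)
        qed simp
        then show ?thesis by (simp add: set_lebesgue_integral_def)
      qed
      \<comment> \<open>The bound does not depend on \<open>z\<close>; this is what makes the
        convergence uniform on the disc.\<close>
      have diff: "norm ((LBINT x:I k. ?f z x) - (LBINT x:{0<..}. ?f z x)) \<le> (LBINT x:{0<..} - I k. w x)"
        if z: "z \<in> cball s d" for k z
      proof -
        have fz: "set_integrable lborel {0<..} (?f z)"
          using z d by (intro integrable) auto
        have Ik: "I k \<in> sets lborel" "{0<..} - I k \<in> sets lborel" by (auto simp: I_def)
        have fI: "set_integrable lborel (I k) (?f z)" "set_integrable lborel ({0<..} - I k) (?f z)"
          using I_subset[of k] Ik by (auto intro: set_integrable_subset[OF fz])
        have "(LBINT x:I k \<union> ({0<..} - I k). ?f z x) = (LBINT x:I k. ?f z x) + (LBINT x:{0<..} - I k. ?f z x)"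
          by (rule set_integral_Un) (use fI in auto)
        also have "I k \<union> ({0<..} - I k) = {0<..}"
          using I_subset[of k] by auto
        finally have "norm ((LBINT x:I k. ?f z x) - (LBINT x:{0<..}. ?f z x)) = norm (LBINT x:{0<..} - I k. ?f z x)"
          by simp
        also have "\<dots> \<le> (LBINT x:{0<..} - I k. norm (?f z x))"
          by (rule set_integral_norm_bound[OF fI(2)])
        also have "\<dots> \<le> (LBINT x:{0<..} - I k. w x)"
          using z by (intro set_integral_mono set_integrable_norm fI set_integrable_subset[OF w] Ik bound) auto
        finally show ?thesis .
      qed
      have "uniform_limit (cball s d) (\<lambda>k s. LBINT x:I k. ?f s x)
        (\<lambda>s. LBINT x:{0<..}. ?f s x) sequentially"
        unfolding uniform_limit_iff dist_norm
      proof (intro allI impI)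
        fix e :: real assume "e > 0"
        with tail have "eventually (\<lambda>k. (LBINT x:{0<..} - I k. w x) < e) sequentially"
          by (rule order_tendstoD)
        then show "\<forall>\<^sub>F k in sequentially. \<forall>z\<in>cball s d.
            norm ((LBINT x:I k. ?f z x) - (LBINT x:{0<..}. ?f z x)) < e"
          by eventually_elim (auto intro: le_less_trans[OF diff])
      qed
      with d show ?thesis by blast
    qed
  qed
qed

section \<open>The product \<open>H n\<close> and convergence of the integral\<close>

lemma H_eq_pochhammer: "H n z = pochhammer (z + 1) (Suc n)"
  unfolding H_def pochhammer_prod
  by (rule prod.reindex_bij_witness[of _ Suc "\<lambda>j. j - 1"]) (auto simp: add_ac)

text \<open>Each of the \<open>n + 1\<close> factors \<open>x + j\<close> is at least
  \<open>x + 1\<close>. The bound yields both the absence of zeros on the half-line and the decay of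
  \<open>1 / H n\<close> at infinity.\<close>

lemma norm_H_ge:
  assumes "x \<ge> 0"
  shows "norm (H n (of_real x)) \<ge> (x + 1) ^ Suc n"
proof -
  have "(x + 1) ^ Suc n = (\<Prod>j=1..n+1. x + 1)" by simp
  also have "\<dots> \<le> (\<Prod>j=1..n+1. norm (complex_of_real x + of_nat j))"
  proof (rule prod_mono)
    fix j assume j: "j \<in> {1..n+1}"
    have "complex_of_real x + of_nat j = of_real (x + real j)" by simp
    then have "norm (complex_of_real x + of_nat j) = x + real j"
      using assms by (simp only: norm_of_real)
    with j assms show "0 \<le> x + 1 \<and> x + 1 \<le> norm (complex_of_real x + of_nat j)" by simp
  qed
  also have "\<dots> = norm (H n (of_real x))"
    unfolding H_def by (rule prod_norm)
  finally show ?thesis .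
qed

lemma H_nonzero:
  assumes "x \<ge> 0"
  shows "H n (of_real x) \<noteq> 0"
proof -
  have "0 < (x + 1) ^ Suc n" using assms by (intro zero_less_power) simp
  also have "\<dots> \<le> norm (H n (of_real x))" using assms by (rule norm_H_ge)
  finally show ?thesis by simp
qed

lemma inverse_H_eq_sum:
  assumes "x \<ge> 0"
  shows "1 / H n (of_real x) =
    (\<Sum>k\<le>n. (- 1) ^ k * of_nat (n choose k) / (of_real x + of_nat (k + 1))) / fact n"
proof -
  have "complex_of_real x + 1 + of_nat k \<noteq> 0" for k
  proof -
    have "complex_of_real x + 1 + of_nat k = of_real (x + 1 + real k)" by simp
    also have "\<dots> \<noteq> 0" using assms by (simp only: of_real_eq_0_iff)
    finally show ?thesis .
  qed
  from sum_binomial_partial_fraction[of n "complex_of_real x + 1", OF this]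
  have "(\<Sum>k\<le>n. (- 1) ^ k * of_nat (n choose k) / (complex_of_real x + 1 + of_nat k)) =
      fact n / H n (of_real x)"
    by (simp add: H_eq_pochhammer)
  then show ?thesis by (simp add: add_ac)
qed

text \<open>Both claims are instances of the Mellin transform results for \<open>1 / H n\<close>;
  only integrability for real exponents has to be supplied.\<close>

lemma
  shows L_integrand_integrable:
      "0 < Re s \<Longrightarrow> Re s < real n + 1 \<Longrightarrow> set_integrable lborel {0<..} (L_integrand n s)"
    and holomorphic_on_L: "L n holomorphic_on {s. 0 < Re s \<and> Re s < real n + 1}"
proof -
  define F where "F = (\<lambda>x::real. 1 / H n (of_real x))"
  have "continuous_on {0<..} (\<lambda>x. H n (complex_of_real x))"
    unfolding H_def by (intro continuous_intros)
  then have F: "continuous_on {0<..} F"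
    unfolding F_def using H_nonzero[of _ n] by (intro continuous_on_divide continuous_on_const) auto
  have int: "set_integrable lborel {0<..} (\<lambda>x. x powr (\<sigma> - 1) *\<^sub>R F x)"
    if \<sigma>: "0 < \<sigma>" "\<sigma> < real n + 1" for \<sigma>
  proof (rule set_integrable_bound)
    \<comment> \<open>The Beta parameters \<open>\<sigma>\<close> and
      \<open>n + 1 - \<sigma>\<close> are both positive exactly on the strip, and their sum turns
      the denominator into the power \<open>(x + 1) ^ Suc n\<close> bounding \<open>H n\<close> from
      below.\<close>
    show "set_integrable lborel {0<..} (\<lambda>x. x powr (\<sigma> - 1) / (x + 1) powr (\<sigma> + (real n + 1 - \<sigma>)))"
      using \<sigma> by (intro set_integrable_Beta_prime) auto
    have "continuous_on {0<..} (\<lambda>x. x powr (\<sigma> - 1) *\<^sub>R F x)"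
      using F by (intro continuous_intros) auto
    then show "set_borel_measurable lborel {0<..} (\<lambda>x. x powr (\<sigma> - 1) *\<^sub>R F x)"
      unfolding set_borel_measurable_def measurable_lborel2
      by (intro borel_measurable_continuous_on_indicator) simp
    have "norm (x powr (\<sigma> - 1) *\<^sub>R F x) \<le> norm (x powr (\<sigma> - 1) / (x + 1) powr (\<sigma> + (real n + 1 - \<sigma>)))"
      if "x > 0" for x
    proof -
      have "(x + 1) powr (\<sigma> + (real n + 1 - \<sigma>)) = (x + 1) ^ Suc n"
        using that powr_realpow[of "x + 1" "Suc n"] by (simp add: add_ac)
      moreover have "x powr (\<sigma> - 1) / norm (H n (of_real x)) \<le> x powr (\<sigma> - 1) / (x + 1) ^ Suc n"
        using that norm_H_ge[of x n] H_nonzero[of x n] by (intro divide_left_mono) auto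
      ultimately show ?thesis
        using that by (simp add: F_def norm_divide)
    qed
    then show "AE x in lborel. x \<in> {0<..} \<longrightarrow> norm (x powr (\<sigma> - 1) *\<^sub>R F x) \<le>
        norm (x powr (\<sigma> - 1) / (x + 1) powr (\<sigma> + (real n + 1 - \<sigma>)))"
      by auto
  qed
  have eq: "L_integrand n s = (\<lambda>x. of_real x powr (s - 1) * F x)" for s
    by (auto simp: L_integrand_def F_def)
  show "0 < Re s \<Longrightarrow> Re s < real n + 1 \<Longrightarrow> set_integrable lborel {0<..} (L_integrand n s)"
    unfolding eq by (rule set_integrable_Mellin[OF F int])
  show "L n holomorphic_on {s. 0 < Re s \<and> Re s < real n + 1}"
    unfolding L_def [abs_def] eq by (rule holomorphic_on_Mellin[OF F int])
qed

section \<open>Evaluation for real exponents between 0 and 1\<close>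

text \<open>Euler's reflection formula. At an integer \<open>s\<close> both sides take the default
  value 0: one Gamma factor sits at a pole and the sine vanishes.\<close>

lemma Beta_reflection_real:
  "complex_of_real (Beta s (1 - s)) = of_real pi / sin (of_real pi * of_real s)"
proof -
  have "complex_of_real (Beta s (1 - s)) = Beta (of_real s) (1 - of_real s)"
    by (subst Beta_complex_of_real[symmetric]) simp
  also have "\<dots> = Gamma (of_real s) * Gamma (1 - of_real s)"
    by (simp add: Beta_def)
  finally show ?thesis by (simp add: Gamma_reflection_complex)
qed

text \<open>The partial fractions of \<open>1 / H n\<close> are integrated one by one. This is
  confined to \<open>0 < s < 1\<close> because a single term decays only like \<open>1 / x\<close>,
  whereas the whole integrand converges on the wider strip.\<close>

lemma L_real_eq:
  assumes s: "0 < s" "s < 1"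
  shows "L n (of_real s) = L_formula n (of_real s)"
proof -
  define c where "c = (\<lambda>k. (- 1) ^ k * complex_of_nat (n choose k))"
  define h where "h = (\<lambda>k x. x powr (s - 1) / (x + real (k + 1)))"
  have h: "set_integrable lborel {0<..} (h k)"
      "(LBINT x:{0<..}. h k x) = Beta s (1 - s) / real (k + 1) powr (1 - s)" for k
  proof -
    \<comment> \<open>The exponent \<open>s + (1 - s)\<close> equals 1; it is spelled out to match
      the Beta integral with parameters \<open>s\<close> and \<open>1 - s\<close>.\<close>
    have eq: "h k x = x powr (s - 1) / (x + real (k + 1)) powr (s + (1 - s))" if "x \<in> {0<..}" for x
      using that by (simp add: h_def)
    show "set_integrable lborel {0<..} (h k)"
      using set_integrable_Beta_prime[of s "1 - s" "real (k + 1)"] s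
      by (subst set_integrable_cong[OF refl refl eq]) auto
    have "(LBINT x:{0<..}. h k x) = (LBINT x:{0<..}. x powr (s - 1) / (x + real (k + 1)) powr (s + (1 - s)))"
      using eq by (intro set_lebesgue_integral_cong) auto
    then show "(LBINT x:{0<..}. h k x) = Beta s (1 - s) / real (k + 1) powr (1 - s)"
      using set_integral_Beta_prime[of s "1 - s" "real (k + 1)"] s by simp
  qed
  have hc: "set_integrable lborel {0<..} (\<lambda>x. complex_of_real (h k x))" for k
    using integrable_of_real[OF h(1)[of k, unfolded set_integrable_def], where 'a = complex]
    by (simp add: set_integrable_def scaleR_conv_of_real)
  have "L n (of_real s) = (LBINT x:{0<..}. (\<Sum>k\<le>n. c k / fact n * of_real (h k x)))"
    unfolding L_def
  proof (intro set_lebesgue_integral_cong allI impI)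
    fix x :: real assume "x \<in> {0<..}"
    then have x: "x > 0" by simp
    have "L_integrand n (of_real s) x = of_real (x powr (s - 1)) * (1 / H n (of_real x))"
      using x powr_of_real[of x "s - 1"] by (simp add: L_integrand_def)
    also have "\<dots> = (\<Sum>k\<le>n. c k / fact n * of_real (h k x))"
      unfolding inverse_H_eq_sum[OF less_imp_le[OF x]]
      by (simp add: sum_distrib_left sum_divide_distrib c_def h_def mult_ac)
    finally show "L_integrand n (of_real s) x = (\<Sum>k\<le>n. c k / fact n * of_real (h k x))" .
  qed simp
  also have "\<dots> = (\<Sum>k\<le>n. LBINT x:{0<..}. c k / fact n * of_real (h k x))"
    using h(1) unfolding set_lebesgue_integral_def scaleR_sum_right
    by (intro Bochner_Integration.integral_sum)
       (rule set_integrable_mult_right[OF hc, unfolded set_integrable_def])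
  \<comment> \<open>Reflection supplies the common factor, and what remains of the
    \<open>k\<close>-th integral is the power of \<open>k + 1\<close> occurring in
    \<open>eta n (1 - s)\<close>.\<close>
  also have "\<dots> = (\<Sum>k\<le>n. c k / fact n * (of_real pi / sin (of_real pi * of_real s) * of_nat (k + 1) powr (- (1 - of_real s))))"
  proof (rule sum.cong)
    fix k
    have "complex_of_real (1 / real (k + 1) powr (1 - s)) = of_real (real (k + 1) powr (- (1 - s)))"
      by (simp only: powr_minus_divide)
    also have "\<dots> = of_nat (k + 1) powr (- (1 - of_real s))"
      by (subst powr_of_real[symmetric]) auto
    finally show "(LBINT x:{0<..}. c k / fact n * of_real (h k x)) =
        c k / fact n * (of_real pi / sin (of_real pi * of_real s) * of_nat (k + 1) powr (- (1 - of_real s)))"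
      by (simp only: set_integral_mult_right set_integral_complex_of_real h(2) of_real_mult
            Beta_reflection_real divide_inverse mult_1_left)
  qed simp
  also have "\<dots> = L_formula n (of_real s)"
    by (simp add: L_formula_def eta_def c_def sum_distrib_left sum_distrib_right atLeast0AtMost mult_ac)
  finally show ?thesis .
qed

section \<open>Continuation to the whole strip and the zeros of \<open>eta n\<close>\<close>

lemma sin_times_pi_eq_0_complex: "sin (z * of_real pi) = 0 \<longleftrightarrow> (z :: complex) \<in> \<int>"
proof -
  have "sin (z * of_real pi) = 0 \<longleftrightarrow> (\<exists>n::int. z * of_real pi = of_int n * of_real pi)"
    by (simp add: sin_eq_0)
  also have "\<dots> \<longleftrightarrow> z \<in> \<int>" by (auto simp: Ints_def)
  finally show ?thesis .
qed

lemma holomorphic_on_eta: "eta n holomorphic_on A"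
  unfolding eta_def [abs_def] by (intro holomorphic_intros)

lemma analytic_on_eta_reflected: "(\<lambda>s. eta n (1 - s)) analytic_on A"
proof -
  have "(\<lambda>s. eta n (1 - s)) holomorphic_on UNIV"
    unfolding eta_def by (intro holomorphic_intros)
  then show ?thesis
    using analytic_on_holomorphic by blast
qed

text \<open>Multiplying by the sine keeps the identity free of singularities, so that it holds at the
  integers of the strip as well and forces the zeros of \<open>eta n\<close> there.\<close>

lemma sin_times_L:
  assumes "0 < Re s" "Re s < real n + 1"
  shows "sin (s * of_real pi) * L n s = of_real pi * eta n (1 - s) / fact n"
proof -
  let ?S = "{s. 0 < Re s \<and> Re s < real n + 1}"
  let ?U = "complex_of_real ` {0<..<1}"
  define f where "f = (\<lambda>s. sin (s * of_real pi) * L n s - of_real pi * eta n (1 - s) / fact n)"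
  have S: "?S = {s. Re s > 0} \<inter> {s. Re s < real n + 1}" by auto
  \<comment> \<open>Identity theorem: \<open>f\<close> is holomorphic on the connected strip and
    vanishes on the real segment from 0 to 1, which accumulates at the interior point
    \<open>1 / 2\<close>.\<close>
  have "f s = 0"
  proof (rule analytic_continuation[where f = f and w = s and S = ?S and U = ?U and \<xi> = "of_real (1 / 2)"])
    show "f holomorphic_on ?S"
      unfolding f_def
      by (intro holomorphic_intros holomorphic_on_L analytic_imp_holomorphic analytic_on_eta_reflected) auto
    show "open ?S" unfolding S by (intro open_Int open_halfspace_Re_gt open_halfspace_Re_lt)
    show "connected ?S" unfolding S
      by (intro convex_connected convex_Int convex_halfspace_Re_gt convex_halfspace_Re_lt)
    show "of_real (1 / 2) islimpt ?U"
      unfolding islimpt_approachable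
    proof (intro allI impI)
      fix e :: real assume "e > 0"
      \<comment> \<open>The witness moves right of \<open>1 / 2\<close> by at most
        \<open>1 / 4\<close>, so it stays in the segment, and by less than \<open>e\<close>.\<close>
      then show "\<exists>z\<in>?U. z \<noteq> of_real (1 / 2) \<and> dist z (of_real (1 / 2)) < e"
        by (intro bexI[of _ "of_real (1 / 2 + min (e / 2) (1 / 4))"] conjI imageI)
           (simp_all only: dist_of_real of_real_eq_iff, auto simp: dist_real_def min_def)
    qed
    show "f z = 0" if z: "z \<in> ?U" for z
    proof -
      obtain t where t: "z = of_real t" "0 < t" "t < 1" using z by auto
      then have "z \<notin> \<int>" by (auto simp: Ints_def complex_eq_iff)
      then have "sin (z * of_real pi) \<noteq> 0" by (simp add: sin_times_pi_eq_0_complex)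
      with t L_real_eq[of t n] show ?thesis by (simp add: f_def L_formula_def)
    qed
  qed (use assms in auto)
  then show ?thesis by (simp add: f_def)
qed

lemma L_eq_L_formula:
  assumes "0 < Re s" "Re s < real n + 1" "s \<notin> \<int>"
  shows "L n s = L_formula n s"
  using sin_times_L[OF assms(1,2)] assms(3) sin_times_pi_eq_0_complex[of s]
  by (simp add: L_formula_def field_simps)

text \<open>At an integer the formula has a default value, so agreement there can only mean a limit.
  \<open>L n\<close> is continuous at \<open>s\<close> and coincides with the formula on a punctured
  neighbourhood.\<close>

lemma L_formula_tendsto_L:
  assumes "0 < Re s" "Re s < real n + 1"
  shows "(L_formula n \<longlongrightarrow> L n s) (at s)"
proof -
  let ?S = "{s. 0 < Re s \<and> Re s < real n + 1}"
  have S: "?S = {s. Re s > 0} \<inter> {s. Re s < real n + 1}" by auto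
  have open_S: "open ?S" unfolding S by (intro open_Int open_halfspace_Re_gt open_halfspace_Re_lt)
  have "isCont (L n) s"
    using holomorphic_on_imp_continuous_on[OF holomorphic_on_L[of n]] assms
    unfolding continuous_on_eq_continuous_at[OF open_S] by blast
  then have "(L n \<longlongrightarrow> L n s) (at s)" by (rule isContD)
  \<comment> \<open>Every set of integers is closed, so the integers other than \<open>s\<close> can
    be removed from the strip without losing openness.\<close>
  moreover have "open (?S - (\<int> - {s}))"
    using open_S by (intro open_Diff closed_subset_Ints) auto
  then have "\<forall>\<^sub>F z in at s. z \<in> ?S - (\<int> - {s})"
    using assms by (intro eventually_at_in_open') auto
  then have "\<forall>\<^sub>F z in at s. L n z = L_formula n z"
    using eventually_neq_at_within[of s s UNIV]
    by eventually_elim (auto intro: L_eq_L_formula)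
  ultimately show ?thesis
    by (rule Lim_transform_eventually)
qed

text \<open>The point \<open>s = m + 1\<close> lies in the strip because \<open>m < n\<close>, and
  there \<open>1 - s = - m\<close>.\<close>

lemma eta_minus_of_nat_eq_0:
  assumes "m < n"
  shows "eta n (- of_nat m) = 0"
proof -
  have "sin ((of_nat m + 1) * complex_of_real pi) = 0"
    by (subst sin_times_pi_eq_0_complex) simp
  with sin_times_L[of "of_nat m + 1" n] assms show ?thesis by simp
qed

section \<open>The meromorphic extension\<close>

lemma L_formula_analytic_at:
  assumes "s \<notin> \<int>"
  shows "L_formula n analytic_on {s}"
  unfolding L_formula_def [abs_def]
  by (intro analytic_intros analytic_on_eta_reflected) (use assms in \<open>simp add: sin_times_pi_eq_0_complex\<close>)

lemma L_formula_meromorphic: "L_formula n meromorphic_on A"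
  unfolding L_formula_def [abs_def]
  by (intro meromorphic_on_mult meromorphic_on_divide analytic_on_imp_meromorphic_on
        analytic_on_eta_reflected analytic_intros)

text \<open>\<open>remove_sings\<close> replaces the default values at the removable singularities
  by the limits. This makes the extension agree with \<open>L n\<close> at the integers of the strip
  too, where the bare formula has the value 0.\<close>

lemma nicely_meromorphic_extension_L:
  fixes n :: nat and s :: complex
  defines "G \<equiv> remove_sings (L_formula n)"
  shows "G nicely_meromorphic_on UNIV"
    and "0 < Re s \<Longrightarrow> Re s < real n + 1 \<Longrightarrow> G s = L n s"
    and "s \<notin> \<int> \<Longrightarrow> G s = L_formula n s"
    and "is_pole G s \<Longrightarrow> s \<in> \<int>"
    and "0 < Re s \<Longrightarrow> Re s < real n + 1 \<Longrightarrow> \<not> is_pole G s"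
proof -
  have "isolated_singularity_at (L_formula n) s"
    by (intro meromorphic_on_isolated_singularity L_formula_meromorphic)
  then have pole: "is_pole G s \<longleftrightarrow> is_pole (L_formula n) s"
    unfolding G_def by (rule is_pole_remove_sings_iff)
  show "G nicely_meromorphic_on UNIV"
    unfolding G_def by (intro remove_sings_nicely_meromorphic L_formula_meromorphic)
  show "0 < Re s \<Longrightarrow> Re s < real n + 1 \<Longrightarrow> G s = L n s"
    unfolding G_def by (intro remove_sings_eqI L_formula_tendsto_L)
  show "s \<notin> \<int> \<Longrightarrow> G s = L_formula n s"
    unfolding G_def by (intro remove_sings_at_analytic L_formula_analytic_at)
  show "is_pole G s \<Longrightarrow> s \<in> \<int>"
    using L_formula_analytic_at[of s n] analytic_at_imp_no_pole pole by blast
  show "\<not> is_pole G s" if "0 < Re s" "Re s < real n + 1"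
    \<comment> \<open>The finite limit \<open>L n s\<close> is incompatible with divergence to
      infinity.\<close>
    unfolding pole unfolding is_pole_def
    using L_formula_tendsto_L[OF that] not_tendsto_and_filterlim_at_infinity[of "at s"] by auto
qed

text \<open>The case \<open>n = 0\<close>: here \<open>eta 0\<close> is constantly 1, and the strip
  contains no integer, so no limit has to be taken.\<close>

lemma Mellin_transform_inverse_plus_1:
  assumes "0 < Re s" "Re s < 1"
  shows "set_integrable lborel {0<..} (\<lambda>x::real. of_real x powr (s - 1) / (of_real x + 1) :: complex)"
    and "(LBINT x:{0<..}. of_real x powr (s - 1) / (of_real x + 1)) = of_real pi / sin (s * of_real pi)"
proof -
  have eq: "L_integrand 0 s = (\<lambda>x. of_real x powr (s - 1) / (of_real x + 1))"
    by (simp add: L_integrand_def H_def fun_eq_iff)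
  show "set_integrable lborel {0<..} (\<lambda>x::real. of_real x powr (s - 1) / (of_real x + 1) :: complex)"
    using L_integrand_integrable[of s 0] assms by (simp add: eq)
  have "s \<notin> \<int>" using assms by (auto simp: Ints_def)
  then have "L 0 s = L_formula 0 s" using assms by (intro L_eq_L_formula) auto
  then show "(LBINT x:{0<..}. of_real x powr (s - 1) / (of_real x + 1)) = of_real pi / sin (s * of_real pi)"
    by (simp add: L_def eq L_formula_def eta_def)
qed

text \<open>The zero of \<open>eta n\<close> at \<open>- m\<close> cancels the pole of
  \<open>pi / sin (s * pi)\<close> where \<open>1 - s = - m\<close>, so the points free of poles are
  \<open>m + 1\<close> for \<open>m < n\<close>, that is 1 to \<open>n\<close>. The point 0 cannot
  be among them: \<open>eta n 1 = 1 / (n + 1)\<close> is nonzero, and the sine leaves a simple pole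
  there.\<close>

theorem theorem2:
  fixes n :: nat
  shows "(eta n holomorphic_on UNIV \<and> (\<forall>m::nat. m < n \<longrightarrow> eta n (- of_nat m) = 0)) \<and>
    (\<forall>s. 0 < Re s \<and> Re s < real n + 1 \<longrightarrow>
       set_integrable lborel {0<..} (L_integrand n s) \<and>
       (s \<notin> \<int> \<longrightarrow> L n s = L_formula n s) \<and>
       (s \<in> \<int> \<longrightarrow> (L_formula n \<longlongrightarrow> L n s) (at s))) \<and>
    (\<exists>G. G nicely_meromorphic_on UNIV \<and>
       (\<forall>s. 0 < Re s \<and> Re s < real n + 1 \<longrightarrow> G s = L n s) \<and>
       (\<forall>s. s \<notin> \<int> \<longrightarrow> G s = L_formula n s) \<and>
       (\<forall>s. is_pole G s \<longrightarrow> s \<in> \<int>) \<and>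
       (\<forall>m::nat. m < n \<longrightarrow> \<not> is_pole G (of_nat m + 1))) \<and>
    (\<forall>s::complex. 0 < Re s \<and> Re s < 1 \<longrightarrow>
       set_integrable lborel {0<..} (\<lambda>x::real. of_real x powr (s - 1) / (of_real x + 1) :: complex) \<and>
       (LBINT x:{0<..}. of_real x powr (s - 1) / (of_real x + 1)) = of_real pi / sin (s * of_real pi))"
proof (intro conjI allI impI)
  show "eta n holomorphic_on UNIV" by (rule holomorphic_on_eta)
  show "eta n (- of_nat m) = 0" if "m < n" for m
    using that by (rule eta_minus_of_nat_eq_0)
  show "\<exists>G. G nicely_meromorphic_on UNIV \<and>
       (\<forall>s. 0 < Re s \<and> Re s < real n + 1 \<longrightarrow> G s = L n s) \<and>
       (\<forall>s. s \<notin> \<int> \<longrightarrow> G s = L_formula n s) \<and>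
       (\<forall>s. is_pole G s \<longrightarrow> s \<in> \<int>) \<and>
       (\<forall>m::nat. m < n \<longrightarrow> \<not> is_pole G (of_nat m + 1))"
    using nicely_meromorphic_extension_L[where n = n]
    by (intro exI[of _ "remove_sings (L_formula n)"]) auto
qed (auto intro: L_integrand_integrable L_eq_L_formula L_formula_tendsto_L Mellin_transform_inverse_plus_1)

end
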